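(* Let $(X,T)$ be a minimal topological dynamical system. Then $(X,T)$ is either weakly equicontinuous in the mean or strong sensitive in the mean.
   Context: A topological dynamical system $(X,T)$ consists of a nonempty compact metric space $X$ with metric $d$ and a continuous map $T:X\to X$. It is minimal if every point of $X$ has dense forward orbit. $S_n$ denotes the group of permutations of $\{1,\dots,n\}$. A point $x\in X$ is weakly equicontinuous in the mean if for every $\varepsilon>0$ there is $\delta>0$ such that for every $y\in X$ with $d(x,y)<\delta$, $\sup_{n\ge1}\inf_{\sigma\in S_n}\frac1n\sum_{i=1}^n d(T^ix,T^{\sigma(i)}y)<\varepsilon$; $(X,T)$ is weakly equicontinuous in the mean if every point of $X$ is. $(X,T)$ is strong sensitive in the mean if there exists $\delta>0$ such that for every $x\in X$ and every $\varepsilon>0$ there exist an integer $n\ge1$ and $y\in X$ with $d(x,y)<\varepsilon$ and $\inf_{\sigma\in S_n}\frac1n\sum_{k=1}^n d(T^kx,T^{\sigma(k)}y)>\delta$. *)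

theory Defs
  imports "HOL-Analysis.Analysis" "HOL-Combinatorics.Permutations"
begin

definition tds :: "'a::metric_space set \<Rightarrow> ('a \<Rightarrow> 'a) \<Rightarrow> bool" where
  "tds X T \<longleftrightarrow> X \<noteq> {} \<and> compact X \<and> continuous_on X T \<and> T ` X \<subseteq> X"

definition minimal_tds :: "'a::metric_space set \<Rightarrow> ('a \<Rightarrow> 'a) \<Rightarrow> bool" where
  "minimal_tds X T \<longleftrightarrow> tds X T \<and> (\<forall>x\<in>X. X \<subseteq> closure (range (\<lambda>n. (T ^^ n) x)))"

(* S_n is rendered as the permutations of {1..n}; the infimum is over a finite nonempty set. *)
definition perm_mean_dist :: "('a::metric_space \<Rightarrow> 'a) \<Rightarrow> nat \<Rightarrow> 'a \<Rightarrow> 'a \<Rightarrow> real" where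
  "perm_mean_dist T n x y =
     (INF \<sigma>\<in>{\<sigma>. \<sigma> permutes {1..n}}.
        (1 / real n) * (\<Sum>i = 1..n. dist ((T ^^ i) x) ((T ^^ (\<sigma> i)) y)))"

(* The real-valued supremum is meaningful when tds X T holds: every perm_mean_dist is then
   bounded by the diameter of X. *)
definition weakly_equicontinuous_in_mean_at ::
    "'a::metric_space set \<Rightarrow> ('a \<Rightarrow> 'a) \<Rightarrow> 'a \<Rightarrow> bool" where
  "weakly_equicontinuous_in_mean_at X T x \<longleftrightarrow>
     (\<forall>\<epsilon>>0. \<exists>\<delta>>0. \<forall>y\<in>X. dist x y < \<delta> \<longrightarrow> (SUP n\<in>{1..}. perm_mean_dist T n x y) < \<epsilon>)"

definition weakly_equicontinuous_in_mean ::
    "'a::metric_space set \<Rightarrow> ('a \<Rightarrow> 'a) \<Rightarrow> bool" where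
  "weakly_equicontinuous_in_mean X T \<longleftrightarrow> (\<forall>x\<in>X. weakly_equicontinuous_in_mean_at X T x)"

definition strong_sensitive_in_mean ::
    "'a::metric_space set \<Rightarrow> ('a \<Rightarrow> 'a) \<Rightarrow> bool" where
  "strong_sensitive_in_mean X T \<longleftrightarrow>
     (\<exists>\<delta>>0. \<forall>x\<in>X. \<forall>\<epsilon>>0. \<exists>n\<ge>1. \<exists>y\<in>X. dist x y < \<epsilon> \<and> perm_mean_dist T n x y > \<delta>)"

end

theory Submission
  imports Defs
begin

text \<open>
  Exclusivity is immediate at a single point: if \<open>\<delta>\<close> is a sensitivity constant, then every
  neighbourhood of \<open>x\<close> contains some \<open>y\<close> for which the supremum in weak equicontinuity exceeds
  \<open>\<delta>\<close>.  Compactness enters because it makes that supremum one of a bounded set.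

  For the dichotomy, suppose that strong sensitivity fails.  Then for every \<open>c > 0\<close> there is a
  stable point \<open>x\<close>: all points of some ball around \<open>x\<close> stay within permuted mean distance \<open>c\<close> of
  \<open>x\<close>, for every \<open>n\<close> at once.  Let \<open>z\<close> be arbitrary.  By minimality some iterate \<open>T\<^sup>m z\<close> lies in
  this ball, and by continuity so does \<open>T\<^sup>m y\<close> for all \<open>y\<close> close to \<open>z\<close>.  The permuted mean
  distance is symmetric and satisfies the triangle inequality, so \<open>T\<^sup>m z\<close> and \<open>T\<^sup>m y\<close> are within
  \<open>2c\<close> of each other for every \<open>n\<close>
  (\<open>perm_mean_dist_le_common_point\<close>).  This bound is pulled back along \<open>T\<^sup>m\<close> without any loss: for
  \<open>y\<close> close enough to \<open>z\<close> the first \<open>m\<close> iterates can be matched identically, and the remaining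
  ones are matched by a shifted permutation (\<open>perm_mean_dist_le_prepend\<close>).  Hence \<open>z\<close> is weakly
  equicontinuous in the mean.
\<close>

text \<open>
  The infimum runs over a finite set and is therefore attained, so an upper bound on it is the same
  as a witnessing permutation; every estimate below combines such witnesses.
\<close>

lemma perm_mean_dist_le_iff:
  assumes "n \<ge> 1"
  shows "perm_mean_dist T n x y \<le> c \<longleftrightarrow>
    (\<exists>\<sigma>. \<sigma> permutes {1..n} \<and> (\<Sum>i=1..n. dist ((T ^^ i) x) ((T ^^ (\<sigma> i)) y)) \<le> real n * c)"
proof -
  let ?P = "{\<sigma>. \<sigma> permutes {1..n}}"
  let ?S = "\<lambda>\<sigma>. (\<Sum>i=1..n. dist ((T ^^ i) x) ((T ^^ (\<sigma> i)) y))"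
  have fin: "finite ((\<lambda>\<sigma>. (1 / real n) * ?S \<sigma>) ` ?P)"
    by (simp add: finite_permutations)
  have ne: "(\<lambda>\<sigma>. (1 / real n) * ?S \<sigma>) ` ?P \<noteq> {}"
    using permutes_id by blast
  have "perm_mean_dist T n x y = Min ((\<lambda>\<sigma>. (1 / real n) * ?S \<sigma>) ` ?P)"
    unfolding perm_mean_dist_def by (rule cInf_eq_Min[OF fin ne])
  then have "perm_mean_dist T n x y \<le> c \<longleftrightarrow> (\<exists>\<sigma>\<in>?P. (1 / real n) * ?S \<sigma> \<le> c)"
    using Min_le_iff[OF fin ne] by simp
  moreover have "(1 / real n) * ?S \<sigma> \<le> c \<longleftrightarrow> ?S \<sigma> \<le> real n * c" for \<sigma>
    using assms by (simp add: field_simps)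
  ultimately show ?thesis by auto
qed

text \<open>
  This is symmetry and the triangle inequality in one step: if \<open>\<sigma>\<close> matches the orbit of \<open>x\<close> with
  that of \<open>u\<close> and \<open>\<tau>\<close> matches it with that of \<open>v\<close>, then \<open>\<tau> \<circ> \<sigma>\<^sup>-\<^sup>1\<close> matches \<open>u\<close> with \<open>v\<close>.
\<close>

lemma perm_mean_dist_le_common_point:
  assumes "n \<ge> 1" "perm_mean_dist T n x u \<le> a" "perm_mean_dist T n x v \<le> b"
  shows "perm_mean_dist T n u v \<le> a + b"
proof -
  obtain \<sigma> where \<sigma>: "\<sigma> permutes {1..n}"
      "(\<Sum>i=1..n. dist ((T ^^ i) x) ((T ^^ (\<sigma> i)) u)) \<le> real n * a"
    using assms perm_mean_dist_le_iff by blast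
  obtain \<tau> where \<tau>: "\<tau> permutes {1..n}"
      "(\<Sum>i=1..n. dist ((T ^^ i) x) ((T ^^ (\<tau> i)) v)) \<le> real n * b"
    using assms perm_mean_dist_le_iff by blast
  let ?\<rho> = "\<tau> \<circ> inv \<sigma>"
  have perm: "?\<rho> permutes {1..n}"
    using \<sigma>(1) \<tau>(1) by (intro permutes_compose permutes_inv)
  have "(\<Sum>i=1..n. dist ((T ^^ i) u) ((T ^^ (?\<rho> i)) v))
      = (\<Sum>i=1..n. dist ((T ^^ (\<sigma> i)) u) ((T ^^ (\<tau> i)) v))"
    using sum.permute[OF \<sigma>(1), of "\<lambda>i. dist ((T ^^ i) u) ((T ^^ (?\<rho> i)) v)"]
    by (simp add: o_def permutes_inverses[OF \<sigma>(1)])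
  also have "\<dots> \<le> (\<Sum>i=1..n. dist ((T ^^ i) x) ((T ^^ (\<sigma> i)) u)
                         + dist ((T ^^ i) x) ((T ^^ (\<tau> i)) v))"
    by (intro sum_mono dist_triangle3)
  also have "\<dots> \<le> real n * (a + b)"
    using \<sigma>(2) \<tau>(2) by (simp add: sum.distrib distrib_left)
  finally show ?thesis
    using perm assms(1) perm_mean_dist_le_iff by blast
qed

lemma permutes_shift:
  fixes \<sigma> :: "nat \<Rightarrow> nat"
  assumes "\<sigma> permutes {1..k}"
  shows "(\<lambda>i. if i \<le> m then i else \<sigma> (i - m) + m) permutes {1..m + k}"
proof -
  define g where "g \<pi> i = (if i \<le> m then i else \<pi> (i - m) + m)" for \<pi> :: "nat \<Rightarrow> nat" and i
  have inv: "inv \<sigma> permutes {1..k}" using assms by (rule permutes_inv)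
  \<comment> \<open>A permutation of \<open>{1..k}\<close> keeps positive numbers positive, so the shifted block stays above \<open>m\<close>.\<close>
  have pos: "\<pi> j > 0 \<and> (j \<le> k \<longrightarrow> \<pi> j \<le> k)" if "\<pi> permutes {1..k}" "j > 0" for \<pi> and j :: nat
    using permutes_in_image[OF that(1), of j] permutes_not_in[OF that(1), of j] that(2)
    by (cases "j \<le> k") auto
  have cancel: "g \<pi>' (g \<pi> i) = i"
    if "\<pi> permutes {1..k}" "\<And>j. \<pi>' (\<pi> j) = j" for \<pi> \<pi>' i
    using pos[OF that(1), of "i - m"] that(2) by (cases "i \<le> m") (auto simp: g_def)
  have range: "g \<pi> i \<in> {1..m + k}" if "\<pi> permutes {1..k}" "i \<in> {1..m + k}" for \<pi> i
    using pos[OF that(1), of "i - m"] that(2) by (cases "i \<le> m") (auto simp: g_def)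
  have "bij_betw (g \<sigma>) {1..m + k} {1..m + k}"
  proof (rule bij_betw_byWitness[where f' = "g (inv \<sigma>)"])
    show "\<forall>i\<in>{1..m + k}. g (inv \<sigma>) (g \<sigma> i) = i"
      using cancel[OF assms] permutes_inverses(2)[OF assms] by blast
    show "\<forall>i\<in>{1..m + k}. g \<sigma> (g (inv \<sigma>) i) = i"
      using cancel[OF inv] permutes_inverses(1)[OF assms] by blast
  qed (use range assms inv in blast)+
  moreover have "g \<sigma> i = i" if "i \<notin> {1..m + k}" for i
  proof (cases "i \<le> m")
    case False
    then have "i - m \<notin> {1..k}" using that by auto
    then show ?thesis using False permutes_not_in[OF assms] by (simp add: g_def)
  qed (simp add: g_def)
  ultimately have "g \<sigma> permutes {1..m + k}"
    by (rule bij_imp_permutes)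
  then show ?thesis unfolding g_def[abs_def] .
qed

text \<open>
  A bound on the permuted mean distance from time \<open>m\<close> on extends to all of the orbit if the first
  \<open>m\<close> iterates are pointwise close, since a weighted average of two numbers bounded by \<open>c\<close>
  is bounded by \<open>c\<close>.
\<close>

lemma perm_mean_dist_le_prepend:
  assumes start: "\<And>i. i \<le> m \<Longrightarrow> dist ((T ^^ i) z) ((T ^^ i) y) \<le> c"
    and tail: "\<And>k. k \<ge> 1 \<Longrightarrow> perm_mean_dist T k ((T ^^ m) z) ((T ^^ m) y) \<le> c"
    and n: "n \<ge> 1"
  shows "perm_mean_dist T n z y \<le> c"
proof (cases "n \<le> m")
  case True
  have "(\<Sum>i=1..n. dist ((T ^^ i) z) ((T ^^ (id i)) y)) \<le> (\<Sum>i=1..n. c)"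
    using True by (intro sum_mono) (simp add: start)
  then show ?thesis
    using permutes_id[of "{1..n}"] n perm_mean_dist_le_iff[OF n] by fastforce
next
  case False
  define k where "k = n - m"
  have k: "k \<ge> 1" "n = m + k" using False by (auto simp: k_def)
  obtain \<sigma> where \<sigma>: "\<sigma> permutes {1..k}"
      "(\<Sum>i=1..k. dist ((T ^^ i) ((T ^^ m) z)) ((T ^^ (\<sigma> i)) ((T ^^ m) y))) \<le> real k * c"
    using tail[OF k(1)] perm_mean_dist_le_iff[OF k(1)] by blast
  let ?\<rho> = "\<lambda>i. if i \<le> m then i else \<sigma> (i - m) + m"
  let ?f = "\<lambda>i. dist ((T ^^ i) z) ((T ^^ (?\<rho> i)) y)"
  have "(\<Sum>i=1..m. ?f i) \<le> (\<Sum>i=1..m. c)"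
    by (intro sum_mono) (simp add: start)
  moreover have "(\<Sum>i=m+1..m+k. ?f i)
      = (\<Sum>i=1..k. dist ((T ^^ i) ((T ^^ m) z)) ((T ^^ (\<sigma> i)) ((T ^^ m) y)))"
    by (rule sum.reindex_bij_witness[of _ "\<lambda>i. i + m" "\<lambda>i. i - m"])
       (auto simp flip: funpow_add[THEN fun_cong, unfolded o_apply])
  moreover have "(\<Sum>i=1..m+k. ?f i) = (\<Sum>i=1..m. ?f i) + (\<Sum>i=m+1..m+k. ?f i)"
    by (rule sum.ub_add_nat) simp
  ultimately have "(\<Sum>i=1..n. ?f i) \<le> real n * c"
    using \<sigma>(2) k(2) by (simp add: distrib_right)
  then show ?thesis
    using permutes_shift[OF \<sigma>(1), of m] k(2) perm_mean_dist_le_iff[OF n] by blast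
qed

lemma tds_funpow:
  assumes "tds X T"
  shows "continuous_on X (T ^^ n) \<and> (T ^^ n) ` X \<subseteq> X"
proof (induction n)
  case (Suc n)
  have "continuous_on X (T \<circ> (T ^^ n))"
    using Suc assms unfolding tds_def
    by (intro continuous_on_compose) (auto intro: continuous_on_subset)
  then show ?case
    using Suc assms unfolding tds_def by (auto simp: o_def)
qed simp

lemma tds_bdd_above_perm_mean_dist:
  assumes "tds X T" "x \<in> X" "y \<in> X"
  shows "bdd_above ((\<lambda>n. perm_mean_dist T n x y) ` {1..})"
proof (rule bdd_aboveI2)
  fix n :: nat assume "n \<in> {1..}"
  then have n: "n \<ge> 1" by simp
  have "dist ((T ^^ i) x) ((T ^^ i) y) \<le> diameter X" for i
  proof (rule diameter_bounded_bound)
    show "bounded X" using assms(1) by (simp add: tds_def compact_imp_bounded)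
  qed (use tds_funpow[OF assms(1), of i] assms in auto)
  then have "(\<Sum>i=1..n. dist ((T ^^ i) x) ((T ^^ (id i)) y)) \<le> (\<Sum>i=1..n. diameter X)"
    by (intro sum_mono) simp
  then show "perm_mean_dist T n x y \<le> diameter X"
    using permutes_id[of "{1..n}"] n perm_mean_dist_le_iff[OF n] by fastforce
qed

lemma tds_iterates_close:
  assumes "tds X T" "z \<in> X" "c > 0"
  obtains \<delta> where "\<delta> > 0"
    "\<And>y i. y \<in> X \<Longrightarrow> dist z y < \<delta> \<Longrightarrow> i \<le> m \<Longrightarrow> dist ((T ^^ i) z) ((T ^^ i) y) < c"
proof -
  have "\<forall>\<^sub>F y in at z within X. dist ((T ^^ i) y) ((T ^^ i) z) < c" for i
    using tds_funpow[OF assms(1), of i] assms(2,3) by (auto simp: continuous_on_def dest: tendstoD)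
  then have "\<forall>\<^sub>F y in at z within X. \<forall>i\<in>{..m}. dist ((T ^^ i) y) ((T ^^ i) z) < c"
    by (intro eventually_ball_finite) auto
  then obtain \<delta> where "\<delta> > 0"
      "\<And>y. y \<in> X \<Longrightarrow> y \<noteq> z \<Longrightarrow> dist y z < \<delta> \<Longrightarrow> \<forall>i\<in>{..m}. dist ((T ^^ i) y) ((T ^^ i) z) < c"
    unfolding eventually_at by blast
  then have "dist ((T ^^ i) z) ((T ^^ i) y) < c" if "y \<in> X" "dist z y < \<delta>" "i \<le> m" for y i
    using that assms(3) by (cases "y = z") (auto simp: dist_commute)
  with \<open>\<delta> > 0\<close> show thesis by (rule that)
qed

lemma weakly_equicontinuous_if_not_strong_sensitive:
  assumes min: "minimal_tds X T" and ns: "\<not> strong_sensitive_in_mean X T"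
  shows "weakly_equicontinuous_in_mean X T"
  unfolding weakly_equicontinuous_in_mean_def weakly_equicontinuous_in_mean_at_def
proof (intro ballI allI impI)
  fix z and \<epsilon> :: real assume z: "z \<in> X" and "\<epsilon> > 0"
  have tds: "tds X T" using min by (simp add: minimal_tds_def)
  \<comment> \<open>The triangle inequality through the stable point costs a factor 2, and the supremum must
      stay strictly below \<open>\<epsilon>\<close>.\<close>
  define c where "c = \<epsilon> / 3"
  have c: "c > 0" "c + c < \<epsilon>" using \<open>\<epsilon> > 0\<close> by (auto simp: c_def)
  from ns c(1) obtain x r where x: "x \<in> X" "r > 0"
    and stable: "\<And>n y. n \<ge> 1 \<Longrightarrow> y \<in> X \<Longrightarrow> dist x y < r \<Longrightarrow> perm_mean_dist T n x y \<le> c"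
    unfolding strong_sensitive_in_mean_def by (meson not_less)
  have "x \<in> closure (range (\<lambda>n. (T ^^ n) z))"
    using min z x(1) unfolding minimal_tds_def by blast
  then have "\<exists>w\<in>range (\<lambda>n. (T ^^ n) z). dist w x < r / 2"
    unfolding closure_approachable using x(2) half_gt_zero by blast
  then obtain m where m: "dist x ((T ^^ m) z) < r / 2"
    by (auto simp: dist_commute)
  obtain \<delta> where \<delta>: "\<delta> > 0"
    and near: "\<And>y i. y \<in> X \<Longrightarrow> dist z y < \<delta> \<Longrightarrow> i \<le> m \<Longrightarrow>
      dist ((T ^^ i) z) ((T ^^ i) y) < min c (r / 2)"
    using tds_iterates_close[OF tds z, of "min c (r / 2)" m] c(1) x(2) by auto
  show "\<exists>\<delta>>0. \<forall>y\<in>X. dist z y < \<delta> \<longrightarrow> (SUP n\<in>{1..}. perm_mean_dist T n z y) < \<epsilon>"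
  proof (intro exI[of _ \<delta>] conjI ballI impI \<delta>)
    fix y assume y: "y \<in> X" "dist z y < \<delta>"
    have in_X: "(T ^^ m) z \<in> X" "(T ^^ m) y \<in> X"
      using tds_funpow[OF tds, of m] z y(1) by auto
    have ym: "dist x ((T ^^ m) y) < r"
      using near[OF y, of m] m dist_triangle[of x "(T ^^ m) y" "(T ^^ m) z"] by simp
    have zm: "dist x ((T ^^ m) z) < r" using m x(2) by simp
    have tail: "perm_mean_dist T k ((T ^^ m) z) ((T ^^ m) y) \<le> c + c" if "k \<ge> 1" for k
      using that stable[OF that in_X(1) zm] stable[OF that in_X(2) ym]
      by (rule perm_mean_dist_le_common_point)
    have start: "dist ((T ^^ i) z) ((T ^^ i) y) \<le> c + c" if "i \<le> m" for i
      using near[OF y that] c(1) by simp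
    have "perm_mean_dist T n z y \<le> c + c" if "n \<ge> 1" for n
      using start tail that by (rule perm_mean_dist_le_prepend)
    then have "(SUP n\<in>{1..}. perm_mean_dist T n z y) \<le> c + c"
      by (intro cSUP_least) auto
    then show "(SUP n\<in>{1..}. perm_mean_dist T n z y) < \<epsilon>"
      using c(2) by simp
  qed
qed

lemma not_weakly_equicontinuous_and_strong_sensitive:
  assumes tds: "tds X T"
  shows "\<not> (weakly_equicontinuous_in_mean X T \<and> strong_sensitive_in_mean X T)"
proof
  assume both: "weakly_equicontinuous_in_mean X T \<and> strong_sensitive_in_mean X T"
  obtain x where x: "x \<in> X" using tds by (auto simp: tds_def)
  obtain c where c: "c > 0"
    and sens: "\<And>\<epsilon>. \<epsilon> > 0 \<Longrightarrow> \<exists>n\<ge>1. \<exists>y\<in>X. dist x y < \<epsilon> \<and> perm_mean_dist T n x y > c"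
    using both x unfolding strong_sensitive_in_mean_def by blast
  obtain \<delta> where \<delta>: "\<delta> > 0"
    and equi: "\<And>y. y \<in> X \<Longrightarrow> dist x y < \<delta> \<Longrightarrow> (SUP n\<in>{1..}. perm_mean_dist T n x y) < c"
    using both x c
    unfolding weakly_equicontinuous_in_mean_def weakly_equicontinuous_in_mean_at_def by blast
  obtain n y where y: "n \<ge> 1" "y \<in> X" "dist x y < \<delta>" "perm_mean_dist T n x y > c"
    using sens[OF \<delta>] by blast
  have "perm_mean_dist T n x y \<le> (SUP n\<in>{1..}. perm_mean_dist T n x y)"
    using y(1) by (intro cSUP_upper tds_bdd_above_perm_mean_dist[OF tds x y(2)]) simp
  then show False using equi[OF y(2,3)] y(4) by simp
qed

theorem corollary5p8:
  fixes X :: "'a::metric_space set" and T :: "'a \<Rightarrow> 'a"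
  assumes "minimal_tds X T"
  shows "(weakly_equicontinuous_in_mean X T \<or> strong_sensitive_in_mean X T) \<and>
    \<not> (weakly_equicontinuous_in_mean X T \<and> strong_sensitive_in_mean X T)"
  using weakly_equicontinuous_if_not_strong_sensitive[OF assms]
    not_weakly_equicontinuous_and_strong_sensitive[of X T] assms
  by (auto simp: minimal_tds_def)

end
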